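(* Let $A$ be an MV-algebra and let $I$ be a proper ideal of $A$ with $|A/I|\ge 3$. Then the ideal-based zero-divisor graph $\Gamma_I(A)$ is connected and $\mathrm{diam}(\Gamma_I(A))\le 3$.
   Context: An MV-algebra is an algebra $(A,\oplus,*,0)$ of type $(2,1,0)$ such that $(A,\oplus,0)$ is a commutative monoid, $x^{**}=x$, $x\oplus 0^*=0^*$, and $(x^*\oplus y)^*\oplus y=(y^*\oplus x)^*\oplus x$ for all $x,y$. Put $1=0^*$, $x\odot y=(x^*\oplus y^* )^*$, and $x\le y$ iff $x^*\oplus y=1$ (a partial order). An ideal of $A$ is a subset $I\subseteq A$ with $0\in I$; $a,b\in I$ implies $a\oplus b\in I$; and $b\in I$, $a\le b$ implies $a\in I$. It is proper if $I\ne A$. With $d(x,y)=(x\odot y^* )\oplus(y\odot x^* )$, the relation $x\equiv_I y\iff d(x,y)\in I$ is a congruence and $A/I$ is the corresponding quotient MV-algebra. For a proper ideal $I$, $\Gamma_I(A)$ is the simple graph with vertex set $\{x\in A\setminus I : \exists y\in A\setminus I,\ x\odot y\in I\}$, in which distinct vertices $x,y$ are adjacent iff $x\odot y\in I$. The diameter of a graph is the supremum of the distances (lengths of shortest paths) between pairs of vertices. *)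

theory Defs
  imports
    "Graph_Theory.Pair_Digraph"
    "Graph_Theory.Digraph_Component"
    "HOL-Algebra.Congruence"
    "HOL-Library.Extended_Nat"
begin

record 'a mv = "'a partial_object" +
  mv_add :: "'a \<Rightarrow> 'a \<Rightarrow> 'a"  (infixl "\<oplus>\<index>" 65)
  mv_neg :: "'a \<Rightarrow> 'a"  ("\<sim>\<index> _" [81] 80)
  mv_zero :: "'a"  ("\<zero>\<index>")

locale mv_algebra =
  fixes A :: "('a, 'm) mv_scheme" (structure)
  assumes add_closed: "x \<in> carrier A \<Longrightarrow> y \<in> carrier A \<Longrightarrow> x \<oplus> y \<in> carrier A"
    and neg_closed: "x \<in> carrier A \<Longrightarrow> \<sim> x \<in> carrier A"
    and zero_closed: "\<zero> \<in> carrier A"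
    and add_assoc: "x \<in> carrier A \<Longrightarrow> y \<in> carrier A \<Longrightarrow> z \<in> carrier A \<Longrightarrow>
          (x \<oplus> y) \<oplus> z = x \<oplus> (y \<oplus> z)"
    and add_comm: "x \<in> carrier A \<Longrightarrow> y \<in> carrier A \<Longrightarrow> x \<oplus> y = y \<oplus> x"
    and add_zero: "x \<in> carrier A \<Longrightarrow> x \<oplus> \<zero> = x"
    and neg_neg: "x \<in> carrier A \<Longrightarrow> \<sim> (\<sim> x) = x"
    and add_neg_zero: "x \<in> carrier A \<Longrightarrow> x \<oplus> \<sim> \<zero> = \<sim> \<zero>"
    and lukasiewicz: "x \<in> carrier A \<Longrightarrow> y \<in> carrier A \<Longrightarrow>
          \<sim> (\<sim> x \<oplus> y) \<oplus> y = \<sim> (\<sim> y \<oplus> x) \<oplus> x"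

definition mv_one :: "('a, 'm) mv_scheme \<Rightarrow> 'a"  ("\<one>\<index>") where
  "\<one>\<^bsub>A\<^esub> = \<sim>\<^bsub>A\<^esub> \<zero>\<^bsub>A\<^esub>"

definition mv_mult :: "('a, 'm) mv_scheme \<Rightarrow> 'a \<Rightarrow> 'a \<Rightarrow> 'a"  (infixl "\<odot>\<index>" 70) where
  "x \<odot>\<^bsub>A\<^esub> y = \<sim>\<^bsub>A\<^esub> (\<sim>\<^bsub>A\<^esub> x \<oplus>\<^bsub>A\<^esub> \<sim>\<^bsub>A\<^esub> y)"

definition mv_le :: "('a, 'm) mv_scheme \<Rightarrow> 'a \<Rightarrow> 'a \<Rightarrow> bool"  (infix "\<preceq>\<index>" 50) where
  "x \<preceq>\<^bsub>A\<^esub> y \<longleftrightarrow> \<sim>\<^bsub>A\<^esub> x \<oplus>\<^bsub>A\<^esub> y = \<one>\<^bsub>A\<^esub>"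

definition mv_dist :: "('a, 'm) mv_scheme \<Rightarrow> 'a \<Rightarrow> 'a \<Rightarrow> 'a" where
  "mv_dist A x y = (x \<odot>\<^bsub>A\<^esub> \<sim>\<^bsub>A\<^esub> y) \<oplus>\<^bsub>A\<^esub> (y \<odot>\<^bsub>A\<^esub> \<sim>\<^bsub>A\<^esub> x)"

definition mv_ideal :: "('a, 'm) mv_scheme \<Rightarrow> 'a set \<Rightarrow> bool" where
  "mv_ideal A I \<longleftrightarrow>
     I \<subseteq> carrier A \<and> \<zero>\<^bsub>A\<^esub> \<in> I \<and>
     (\<forall>a\<in>I. \<forall>b\<in>I. a \<oplus>\<^bsub>A\<^esub> b \<in> I) \<and>
     (\<forall>b\<in>I. \<forall>a\<in>carrier A. a \<preceq>\<^bsub>A\<^esub> b \<longrightarrow> a \<in> I)"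

definition mv_proper_ideal :: "('a, 'm) mv_scheme \<Rightarrow> 'a set \<Rightarrow> bool" where
  "mv_proper_ideal A I \<longleftrightarrow> mv_ideal A I \<and> I \<noteq> carrier A"

definition mv_cong :: "('a, 'm) mv_scheme \<Rightarrow> 'a set \<Rightarrow> 'a rel" where
  "mv_cong A I = {(x, y). x \<in> carrier A \<and> y \<in> carrier A \<and> mv_dist A x y \<in> I}"

text \<open>
  Elements of the quotient are congruence classes. The operations collect the classes of all
  values at representatives; for an ideal this is a single class, since the relation is a
  congruence.
\<close>

definition mv_quotient :: "('a, 'm) mv_scheme \<Rightarrow> 'a set \<Rightarrow> 'a set mv" where
  "mv_quotient A I =
     \<lparr> carrier = carrier A // mv_cong A I,
       mv_add = (\<lambda>X Y. \<Union>x\<in>X. \<Union>y\<in>Y. mv_cong A I `` {x \<oplus>\<^bsub>A\<^esub> y}),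
       mv_neg = (\<lambda>X. \<Union>x\<in>X. mv_cong A I `` {\<sim>\<^bsub>A\<^esub> x}),
       mv_zero = mv_cong A I `` {\<zero>\<^bsub>A\<^esub>} \<rparr>"

text \<open>
  A simple graph is represented as a loop-free digraph without parallel arcs in which every
  edge occurs in both orientations (locale \<^locale>\<open>pair_bidirected_digraph\<close>).
\<close>

definition zero_div_graph :: "('a, 'm) mv_scheme \<Rightarrow> 'a set \<Rightarrow> 'a pair_pre_digraph" where
  "zero_div_graph A I =
     (let V = {x \<in> carrier A - I. \<exists>y\<in>carrier A - I. x \<odot>\<^bsub>A\<^esub> y \<in> I}
      in \<lparr> pverts = V, parcs = {(x, y). x \<in> V \<and> y \<in> V \<and> x \<noteq> y \<and> x \<odot>\<^bsub>A\<^esub> y \<in> I} \<rparr>)"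

lemma (in mv_algebra) mult_comm:
  "x \<in> carrier A \<Longrightarrow> y \<in> carrier A \<Longrightarrow> x \<odot> y = y \<odot> x"
  by (simp add: mv_mult_def add_comm neg_closed)

lemma (in mv_algebra) pair_bidirected_digraph_zero_div_graph:
  "pair_bidirected_digraph (zero_div_graph A I)"
proof
  show "symmetric (zero_div_graph A I)"
    by (auto simp: symmetric_def zero_div_graph_def Let_def mult_comm intro!: symI)
qed (auto simp: zero_div_graph_def Let_def)

text \<open>Distances and the diameter are \<open>\<infinity>\<close> when no connecting path exists or path lengths
  are unbounded: the infimum of the empty set of extended naturals is \<open>\<infinity>\<close>.\<close>

definition graph_dist :: "('a, 'b) pre_digraph \<Rightarrow> 'a \<Rightarrow> 'a \<Rightarrow> enat" where
  "graph_dist G u v = (INF p \<in> {p. pre_digraph.apath G u p v}. enat (length p))"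

definition diam :: "('a, 'b) pre_digraph \<Rightarrow> enat" where
  "diam G = (SUP u \<in> verts G. SUP v \<in> verts G. graph_dist G u v)"

end

theory Submission
  imports Defs
begin

text \<open>
  Modulo the ideal, \<open>\<sim> x\<close> is the largest element annihilating \<open>x\<close>, so the vertices are
  exactly the \<open>x\<close> with \<open>x, \<sim> x \<notin> I\<close>; this set is closed under negation, and every \<open>x\<close> is joined to
  \<open>\<sim> x\<close> unless \<open>x = \<sim> x\<close>. For distinct non-adjacent vertices \<open>x, y\<close> put \<open>z = \<sim> (x \<oplus> y)\<close>.
  If \<open>z \<notin> I\<close>, then \<open>x - z - y\<close> is a path; if \<open>z \<in> I\<close>, then
  \<open>\<sim> x\<close> and \<open>\<sim> y\<close> annihilate each other and \<open>x - \<sim> x - \<sim> y - y\<close> is a path once repeated vertices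
  are dropped. Without vertices the quotient would have only the two classes \<open>0\<close> and \<open>1\<close>.
\<close>

context mv_algebra
begin

section \<open>Arithmetic and order of MV-algebras\<close>

lemma one_closed: "\<one> \<in> carrier A"
  by (simp add: mv_one_def neg_closed zero_closed)

lemma mult_closed: "x \<in> carrier A \<Longrightarrow> y \<in> carrier A \<Longrightarrow> x \<odot> y \<in> carrier A"
  by (simp add: mv_mult_def add_closed neg_closed)

lemma neg_one: "\<sim> \<one> = \<zero>"
  by (simp add: mv_one_def neg_neg zero_closed)

lemma neg_mult: "x \<in> carrier A \<Longrightarrow> y \<in> carrier A \<Longrightarrow> \<sim> (x \<odot> y) = \<sim> x \<oplus> \<sim> y"
  by (simp add: mv_mult_def neg_neg add_closed neg_closed)

lemma neg_add: "x \<in> carrier A \<Longrightarrow> y \<in> carrier A \<Longrightarrow> \<sim> (x \<oplus> y) = \<sim> x \<odot> \<sim> y"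
  by (simp add: mv_mult_def neg_neg)

lemma add_one: "x \<in> carrier A \<Longrightarrow> x \<oplus> \<one> = \<one>"
  by (simp add: mv_one_def add_neg_zero)

lemma zero_add: "x \<in> carrier A \<Longrightarrow> \<zero> \<oplus> x = x"
  using add_comm[of \<zero> x] by (simp add: add_zero zero_closed)

text \<open>Take \<open>y = \<one>\<close> in \<open>lukasiewicz\<close>: the left side collapses to
  \<open>\<one>\<close>, the right one to \<open>\<sim> x \<oplus> x\<close>.\<close>

lemma neg_add_self:
  assumes "x \<in> carrier A"
  shows "\<sim> x \<oplus> x = \<one>"
  using lukasiewicz[OF assms one_closed] assms
  by (simp add: add_one neg_one zero_add one_closed zero_closed neg_closed)

lemma le_add:
  assumes "x \<in> carrier A" "y \<in> carrier A"
  shows "x \<preceq> x \<oplus> y" "x \<preceq> y \<oplus> x"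
proof -
  have "\<sim> x \<oplus> (x \<oplus> y) = \<one> \<oplus> y"
    using assms by (simp add: add_assoc[symmetric] neg_closed neg_add_self)
  also have "\<dots> = \<one>"
    using add_comm[of \<one> y] assms by (simp add: add_one one_closed)
  finally show "x \<preceq> x \<oplus> y" "x \<preceq> y \<oplus> x"
    using assms by (simp_all add: mv_le_def add_comm)
qed

lemma mult_le:
  assumes "x \<in> carrier A" "y \<in> carrier A"
  shows "x \<odot> y \<preceq> x"
proof -
  have "\<sim> (x \<odot> y) \<oplus> x = x \<oplus> (\<sim> x \<oplus> \<sim> y)"
    using assms by (simp add: neg_mult add_comm neg_closed add_closed)
  also have "\<dots> = \<sim> (\<sim> x) \<oplus> (\<sim> x \<oplus> \<sim> y)"
    using assms by (simp add: neg_neg)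
  also have "\<dots> = \<one>"
    using le_add(1)[of "\<sim> x" "\<sim> y"] assms by (simp add: mv_le_def neg_closed)
  finally show ?thesis by (simp add: mv_le_def)
qed

text \<open>The axiom \<open>lukasiewicz\<close>, applied to \<open>x\<close> and
  \<open>\<sim> y\<close>, rewrites the upper bound as a sum having \<open>x\<close> as a
  summand.\<close>

lemma le_mult_add_neg:
  assumes "x \<in> carrier A" "y \<in> carrier A"
  shows "x \<preceq> (x \<odot> y) \<oplus> \<sim> y"
proof -
  have "(x \<odot> y) \<oplus> \<sim> y = \<sim> (y \<oplus> x) \<oplus> x"
    using lukasiewicz[of x "\<sim> y"] assms by (simp add: mv_mult_def neg_closed neg_neg)
  with assms show ?thesis
    by (simp add: le_add add_closed neg_closed)
qed

lemma mult_neg_self: "x \<in> carrier A \<Longrightarrow> x \<odot> \<sim> x = \<zero>"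
  by (simp add: mv_mult_def neg_closed neg_add_self neg_neg neg_one)

text \<open>An element annihilates the negation of anything above it. This later makes
  \<open>\<sim> (x \<oplus> y)\<close> a common neighbour of \<open>x\<close> and
  \<open>y\<close>.\<close>

lemma mult_neg_add:
  assumes "x \<in> carrier A" "y \<in> carrier A"
  shows "x \<odot> \<sim> (x \<oplus> y) = \<zero>" "x \<odot> \<sim> (y \<oplus> x) = \<zero>"
  using le_add[OF assms] assms
  by (simp_all add: mv_mult_def mv_le_def neg_neg add_closed neg_one)

section \<open>Ideals\<close>

lemma ideal_subset: "mv_ideal A I \<Longrightarrow> I \<subseteq> carrier A"
  by (simp add: mv_ideal_def)

lemma ideal_zero: "mv_ideal A I \<Longrightarrow> \<zero> \<in> I"
  by (simp add: mv_ideal_def)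

lemma ideal_add: "mv_ideal A I \<Longrightarrow> a \<in> I \<Longrightarrow> b \<in> I \<Longrightarrow> a \<oplus> b \<in> I"
  by (simp add: mv_ideal_def)

lemma ideal_downward: "mv_ideal A I \<Longrightarrow> b \<in> I \<Longrightarrow> a \<preceq> b \<Longrightarrow> a \<in> carrier A \<Longrightarrow> a \<in> I"
  by (simp add: mv_ideal_def)

lemma ideal_mult:
  assumes "mv_ideal A I" "a \<in> I" "b \<in> carrier A"
  shows "a \<odot> b \<in> I"
  using ideal_downward[OF assms(1,2) mult_le] ideal_subset[OF assms(1)] assms
  by (auto simp: mult_closed)

text \<open>Modulo \<open>I\<close> the factor \<open>b\<close> is \<open>\<one>\<close>.
  Concretely, \<open>a\<close> lies below \<open>(a \<odot> b) \<oplus> \<sim> b\<close>, a sum of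
  two members of \<open>I\<close>.\<close>

lemma ideal_cancel:
  assumes "mv_ideal A I" "a \<in> carrier A" "b \<in> carrier A" "a \<odot> b \<in> I" "\<sim> b \<in> I"
  shows "a \<in> I"
  using ideal_downward[OF assms(1) ideal_add[OF assms(1,4,5)] le_mult_add_neg] assms by blast

lemma ideal_add_iff:
  assumes "mv_ideal A I" "a \<in> carrier A" "b \<in> carrier A"
  shows "a \<oplus> b \<in> I \<longleftrightarrow> a \<in> I \<and> b \<in> I"
  using ideal_add[OF assms(1)] ideal_downward[OF assms(1)] le_add assms(2,3) by metis

section \<open>Vertices and arcs of the graph\<close>

lemma verts_zero_div_graph:
  assumes "mv_ideal A I"
  shows "pverts (zero_div_graph A I) = {x \<in> carrier A. x \<notin> I \<and> \<sim> x \<notin> I}"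
proof -
  \<comment> \<open>If \<open>\<sim> x\<close> were in \<open>I\<close>, cancelling \<open>x\<close>
    would put the witness \<open>y\<close> into \<open>I\<close>.\<close>
  have "\<sim> x \<notin> I"
    if "x \<in> carrier A" "y \<in> carrier A" "y \<notin> I" "x \<odot> y \<in> I" for x y
    using ideal_cancel[OF assms, of y x] that mult_comm by auto
  moreover have "x \<odot> \<sim> x \<in> I" "\<sim> x \<in> carrier A" if "x \<in> carrier A" for x
    using that assms by (simp_all add: mult_neg_self ideal_zero neg_closed)
  ultimately show ?thesis
    unfolding zero_div_graph_def Let_def by (simp add: set_eq_iff) blast
qed

lemma arcs_zero_div_graph:
  "(x, y) \<in> parcs (zero_div_graph A I) \<longleftrightarrow>
     x \<in> pverts (zero_div_graph A I) \<and> y \<in> pverts (zero_div_graph A I) \<and> x \<noteq> y \<and> x \<odot> y \<in> I"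
  by (simp add: zero_div_graph_def Let_def)

section \<open>The congruence classes of 0 and 1\<close>

lemma ideal_quotient_class:
  assumes "mv_ideal A I" "x \<in> I"
  shows "mv_cong A I `` {x} = I"
proof -
  have "y \<in> I" if "y \<in> carrier A" "mv_dist A x y \<in> I" for y
  proof -
    have "x \<in> carrier A" using assms ideal_subset by auto
    with that have "y \<odot> \<sim> x \<in> I"
      using assms(1) by (simp add: mv_dist_def ideal_add_iff mult_closed neg_closed)
    \<comment> \<open>The factor \<open>\<sim> x\<close> can be cancelled since its negation is
      \<open>x\<close>, a member of \<open>I\<close>.\<close>
    then show ?thesis
      using ideal_cancel[OF assms(1), of y "\<sim> x"] that assms \<open>x \<in> carrier A\<close>
      by (simp add: neg_closed neg_neg)
  qed
  moreover have "mv_dist A x y \<in> I" if "y \<in> I" for y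
    unfolding mv_dist_def using that assms ideal_subset[OF assms(1)]
    by (auto intro!: ideal_add ideal_mult neg_closed)
  ultimately show ?thesis
    using assms ideal_subset[OF assms(1)] by (auto simp: mv_cong_def)
qed

text \<open>Negation only swaps the two summands of the distance. This carries the class of 0 to the
  class of 1.\<close>

lemma dist_neg:
  "x \<in> carrier A \<Longrightarrow> y \<in> carrier A \<Longrightarrow> mv_dist A (\<sim> x) (\<sim> y) = mv_dist A x y"
  by (simp add: mv_dist_def neg_neg mult_comm add_comm mult_closed neg_closed)

lemma coideal_quotient_class:
  assumes "mv_ideal A I" "x \<in> carrier A" "\<sim> x \<in> I"
  shows "mv_cong A I `` {x} = {y \<in> carrier A. \<sim> y \<in> I}"
proof -
  have "y \<in> mv_cong A I `` {x} \<longleftrightarrow> \<sim> y \<in> mv_cong A I `` {\<sim> x}" if "y \<in> carrier A" for y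
    using that assms by (simp add: mv_cong_def dist_neg neg_closed)
  then show ?thesis
    unfolding ideal_quotient_class[OF assms(1,3)] by (auto simp: mv_cong_def)
qed

lemma verts_zero_div_graph_nonempty:
  assumes "mv_ideal A I"
    and "infinite (carrier (mv_quotient A I)) \<or> card (carrier (mv_quotient A I)) \<ge> 3"
  shows "pverts (zero_div_graph A I) \<noteq> {}"
proof
  assume "pverts (zero_div_graph A I) = {}"
  then have "x \<in> I \<or> \<sim> x \<in> I" if "x \<in> carrier A" for x
    using that by (auto simp: verts_zero_div_graph[OF assms(1)])
  then have sub: "carrier (mv_quotient A I) \<subseteq> {I, {y \<in> carrier A. \<sim> y \<in> I}}"
    using ideal_quotient_class[OF assms(1)] coideal_quotient_class[OF assms(1)]
    by (auto simp: mv_quotient_def quotient_def)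
  have "card (carrier (mv_quotient A I)) \<le> card {I, {y \<in> carrier A. \<sim> y \<in> I}}"
    by (rule card_mono[OF _ sub]) simp
  also have "\<dots> \<le> 2"
    by (simp add: card_insert_if)
  \<comment> \<open>As \<open>card\<close> is 0 on infinite sets, the infinite alternative is
    refuted by \<open>finite_subset\<close>, not by the bound.\<close>
  finally show False
    using assms(2) finite_subset[OF sub] by auto
qed

section \<open>Paths with at most three edges\<close>

lemma zero_div_graph_short_apath:
  assumes I: "mv_ideal A I"
    and x: "x \<in> pverts (zero_div_graph A I)" and y: "y \<in> pverts (zero_div_graph A I)"
  shows "\<exists>p. pre_digraph.apath (with_proj (zero_div_graph A I)) x p y \<and> length p \<le> 3"
proof -
  interpret pair_bidirected_digraph "zero_div_graph A I"
    by (rule pair_bidirected_digraph_zero_div_graph)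
  let ?V = "pverts (zero_div_graph A I)"
  note verts = verts_zero_div_graph[OF I]
  have xc: "x \<in> carrier A" "\<sim> x \<in> carrier A" and yc: "y \<in> carrier A" "\<sim> y \<in> carrier A"
    using x y by (simp_all add: verts neg_closed)
  have nV: "\<sim> x \<in> ?V" "\<sim> y \<in> ?V"
    using x y xc yc by (simp_all add: verts neg_neg)
  have zero: "\<zero> \<in> I" by (rule ideal_zero[OF I])
  consider "x = y" | "x \<noteq> y" "x \<odot> y \<in> I"
    | "x \<noteq> y" "x \<odot> y \<notin> I" "\<sim> (x \<oplus> y) \<notin> I" | "x \<noteq> y" "x \<odot> y \<notin> I" "\<sim> (x \<oplus> y) \<in> I"
    by blast
  then show ?thesis
  proof cases
    case 1
    \<comment> \<open>Paths are lists of arcs, so \<open>length\<close> counts edges and the empty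
      list joins \<open>x\<close> to itself.\<close>
    then show ?thesis using x by (intro exI[of _ "[]"]) (simp add: apath_simps)
  next
    case 2
    then show ?thesis using x y
      by (intro exI[of _ "[(x, y)]"]) (simp add: apath_simps arcs_zero_div_graph)
  next
    case 3
    let ?z = "\<sim> (x \<oplus> y)"
    \<comment> \<open>The negation of \<open>?z\<close> is \<open>x \<oplus> y\<close>, which avoids
      \<open>I\<close> because \<open>x\<close> does.\<close>
    have z: "?z \<in> ?V"
      using 3 I x xc yc by (simp add: verts ideal_add_iff add_closed neg_closed neg_neg)
    have xz: "x \<odot> ?z \<in> I" and zy: "?z \<odot> y \<in> I"
      using mult_neg_add xc yc zero by (simp_all add: mult_comm[of ?z] neg_closed add_closed)
    \<comment> \<open>If \<open>?z\<close> were \<open>x\<close> or \<open>y\<close>, then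
      \<open>zy\<close> or \<open>xz\<close> would say \<open>x \<odot> y \<in> I\<close>.\<close>
    have "x \<noteq> ?z" using zy 3 by metis
    moreover have "?z \<noteq> y" using xz 3 by metis
    ultimately show ?thesis using 3 x y z xz zy
      by (intro exI[of _ "[(x, ?z), (?z, y)]"]) (simp add: apath_simps arcs_zero_div_graph)
  next
    case 4
    have nn: "\<sim> x \<odot> \<sim> y \<in> I" using 4 xc yc by (simp add: neg_add)
    have xx: "x \<odot> \<sim> x \<in> I" and yy: "\<sim> y \<odot> y \<in> I"
      using xc yc zero by (simp_all add: mult_neg_self mult_comm[of "\<sim> y"])
    \<comment> \<open>Either of the next two equalities would turn \<open>yy\<close> or
      \<open>xx\<close> into \<open>x \<odot> y \<in> I\<close>.\<close>
    have "x \<noteq> \<sim> y" using yy 4 by auto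
    have "\<sim> x \<noteq> y" using xx 4 by auto
    have "\<sim> x \<noteq> \<sim> y" using 4 xc yc neg_neg by metis
    note ne = \<open>x \<noteq> \<sim> y\<close> \<open>\<sim> x \<noteq> y\<close> \<open>\<sim> x \<noteq> \<sim> y\<close> \<open>x \<noteq> y\<close>
    \<comment> \<open>An \<open>apath\<close> repeats no vertex, so an end fixed by negation loses
      its outer arc. If both ends are fixed, \<open>nn\<close> contradicts
      \<open>x \<odot> y \<notin> I\<close>.\<close>
    consider "x = \<sim> x" "y = \<sim> y" | "x = \<sim> x" "y \<noteq> \<sim> y" | "x \<noteq> \<sim> x" "y = \<sim> y"
      | "x \<noteq> \<sim> x" "y \<noteq> \<sim> y" by blast
    then show ?thesis
    proof cases
      case 1
      with nn 4 show ?thesis by simp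
    next
      case 2
      then have "x \<odot> \<sim> y \<in> I" using nn by simp
      with 2 ne x y nV yy show ?thesis
        by (intro exI[of _ "[(x, \<sim> y), (\<sim> y, y)]"]) (simp add: apath_simps arcs_zero_div_graph)
    next
      case 3
      then have "\<sim> x \<odot> y \<in> I" using nn by simp
      with 3 ne x y nV xx show ?thesis
        by (intro exI[of _ "[(x, \<sim> x), (\<sim> x, y)]"]) (simp add: apath_simps arcs_zero_div_graph)
    next
      case 4
      with ne x y nV xx yy nn show ?thesis
        by (intro exI[of _ "[(x, \<sim> x), (\<sim> x, \<sim> y), (\<sim> y, y)]"])
          (simp add: apath_simps arcs_zero_div_graph)
    qed
  qed
qed

end

section \<open>Connectedness and diameter from directed paths\<close>

lemma (in wf_digraph) strongly_connected_imp_connected: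
  assumes "strongly_connected G"
  shows "connected G"
  unfolding connected_conv
proof (intro conjI ballI)
  show "verts G \<noteq> {}" using assms by (simp add: strongly_connected_def)
next
  \<comment> \<open>Connectedness is reachability along the symmetric closure of the arcs, which
    contains the arcs themselves.\<close>
  fix u v assume "u \<in> verts G" "v \<in> verts G"
  then have "(u, v) \<in> rtrancl_on (verts G) (arcs_ends G)"
    using assms by (auto simp: strongly_connected_def reachable_def)
  then show "(u, v) \<in> rtrancl_on (verts G) ((arcs_ends G)\<^sup>s)"
    by (rule rtrancl_on_mono[rotated 2]) (auto simp: symcl_def)
qed

text \<open>Distance is an infimum over paths, so one short path per pair bounds it.\<close>

lemma diam_le:
  assumes "\<And>u v. u \<in> verts G \<Longrightarrow> v \<in> verts G \<Longrightarrow>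
      \<exists>p. pre_digraph.apath G u p v \<and> enat (length p) \<le> n"
  shows "diam G \<le> n"
  unfolding diam_def graph_dist_def
  using assms by (intro SUP_least) (metis (mono_tags, lifting) INF_lower2 mem_Collect_eq)

theorem theorem4p3:
  fixes A :: "('a, 'm) mv_scheme" and I :: "'a set"
  assumes "mv_algebra A"
    and "mv_proper_ideal A I"
    and "infinite (carrier (mv_quotient A I)) \<or> card (carrier (mv_quotient A I)) \<ge> 3"
  shows "Digraph_Component.connected (with_proj (zero_div_graph A I)) \<and>
         diam (with_proj (zero_div_graph A I)) \<le> 3"
proof
  interpret mv_algebra A by fact
  interpret pair_bidirected_digraph "zero_div_graph A I"
    by (rule pair_bidirected_digraph_zero_div_graph)
  have I: "mv_ideal A I" using assms(2) by (simp add: mv_proper_ideal_def)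
  note short = zero_div_graph_short_apath[OF I]
  show "Digraph_Component.connected (with_proj (zero_div_graph A I))"
  proof (rule strongly_connected_imp_connected, rule strongly_connectedI)
    \<comment> \<open>Connectedness includes having a vertex; this is where the size of the quotient
      enters.\<close>
    show "verts (with_proj (zero_div_graph A I)) \<noteq> {}"
      using verts_zero_div_graph_nonempty[OF I assms(3)] by simp
    show "u \<rightarrow>\<^sup>*\<^bsub>with_proj (zero_div_graph A I)\<^esub> v"
      if "u \<in> verts (with_proj (zero_div_graph A I))"
        "v \<in> verts (with_proj (zero_div_graph A I))" for u v
      using short[of u v] that by (auto simp: reachable_awalk apath_def)
  qed
  show "diam (with_proj (zero_div_graph A I)) \<le> 3"
  proof (rule diam_le)
    fix u v
    assume "u \<in> verts (with_proj (zero_div_graph A I))" "v \<in> verts (with_proj (zero_div_graph A I))"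
    then show "\<exists>p. pre_digraph.apath (with_proj (zero_div_graph A I)) u p v \<and> enat (length p) \<le> 3"
      using short[of u v] by (auto simp: numeral_eq_enat)
  qed
qed

end
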